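(* The reduced problem on the critical manifold $C_0$ coincides with the vector field $Z_s(z)$ on $\Sigma_s$; that is, written in the coordinates $(x,\theta)$, both are $(x',\theta')=(0,1)$.
   Context: Parameters: $\gamma>0$, $\mu_s>\mu_d>0$, $0<\delta<1$; $\xi(x,\theta)=\gamma^2x+\sin\theta$, $\theta\in\mathbb{T}^1=\mathbb{R}/2\pi\mathbb{Z}$. The friction oscillator is $z'=Z(z)$, $z=(x,y,\theta)$: $x'=y$, $y'=-\xi(x,\theta)+\mu(y,\xi(x,\theta))$, $\theta'=1$, with $\mu(y,\xi)=-\mu_d\,\mathrm{sign}(y)$ if $y\neq0$, $\mu(0,\xi)=\xi$ if $|\xi|<\mu_s$, $\mu(0,\xi)=\mu_s\,\mathrm{sign}(\xi)$ if $|\xi|>\mu_s$. $\Sigma_s=\{(x,y,\theta):y=0,\ -\mu_s<\xi<\mu_s\}$, and $Z_s$ is $Z$ restricted to $\Sigma_s$, regarded as a two-dimensional vector field in $(x,\theta)$ (and extended to the closure of $\Sigma_s$). $\phi:\mathbb{R}\to\mathbb{R}$ is an odd $C^k$ function ($1\le k\le\infty$) with $\phi(y)=1$ for $y\ge1$, $\phi(\delta)=\mu_s/\mu_d$, $\phi'(y)>0$ for $0<y<\delta$, $\phi'(\delta)=0$, $\phi'(y)<0$ for $\delta<y<1$, $\phi''(\delta)<0$. The regularized system in the variable $\hat y=\varepsilon^{-1}y$ is the slow problem $x'=\varepsilon\hat y$, $\varepsilon\hat y'=-\xi(x,\theta)-\mu_d\phi(\hat y)$, $\theta'=1$. The reduced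 problem is its limit for $\varepsilon\to0$: $x'=0$, $0=-\xi(x,\theta)-\mu_d\phi(\hat y)$, $\theta'=1$, whose solutions are constrained to the critical manifold $C_0=\{(x,\hat y,\theta)\in\mathbb{R}^2\times\mathbb{T}^1:\xi(x,\theta)+\mu_d\phi(\hat y)=0\}$. *)

theory Defs
  imports "HOL-Analysis.Analysis" "HOL-Library.Extended_Nat"
begin

quotient_type angle = real / "\<lambda>s t. \<exists>k::int. s = t + 2 * pi * of_int k"
  morphisms rep_angle angle_of
proof (rule equivpI)
  show "reflp (\<lambda>s t. \<exists>k::int. s = t + 2 * pi * of_int k)"
    by (rule reflpI, rule exI[of _ 0]) simp
  show "symp (\<lambda>s t. \<exists>k::int. s = t + 2 * pi * of_int k)"
  proof (rule sympI)
    fix s t :: real assume "\<exists>k::int. s = t + 2 * pi * of_int k"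
    then obtain k :: int where "s = t + 2 * pi * of_int k" by blast
    then have "t = s + 2 * pi * of_int (- k)" by simp
    then show "\<exists>k::int. t = s + 2 * pi * of_int k" by blast
  qed
  show "transp (\<lambda>s t. \<exists>k::int. s = t + 2 * pi * of_int k)"
  proof (rule transpI)
    fix r s t :: real
    assume "\<exists>k::int. r = s + 2 * pi * of_int k" "\<exists>k::int. s = t + 2 * pi * of_int k"
    then obtain k l :: int where "r = s + 2 * pi * of_int k" "s = t + 2 * pi * of_int l"
      by blast
    then have "r = t + 2 * pi * of_int (k + l)" by (simp add: algebra_simps)
    then show "\<exists>k::int. r = t + 2 * pi * of_int k" by blast
  qed
qed

text \<open>The circle \<open>\<real> / 2\<pi>\<int>\<close> carries the quotient topology.\<close>

instantiation angle :: topological_space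
begin

definition open_angle :: "angle set \<Rightarrow> bool" where
  "open_angle U \<longleftrightarrow> open (angle_of -` U)"

instance
proof
  show "open (UNIV :: angle set)" by (simp add: open_angle_def)
next
  fix S T :: "angle set" assume "open S" "open T"
  then show "open (S \<inter> T)" by (simp add: open_angle_def vimage_Int open_Int)
next
  fix K :: "angle set set" assume "\<forall>S\<in>K. open S"
  then show "open (\<Union>K)" by (auto simp add: open_angle_def vimage_Union)
qed

end

lift_definition sin_angle :: "angle \<Rightarrow> real" is sin
proof -
  fix s t :: real assume "\<exists>k::int. s = t + 2 * pi * of_int k"
  then obtain k :: int where "s = t + 2 * pi * of_int k" by blast
  then show "sin s = sin t" by (simp add: sin_add)
qed

text \<open>A state is \<open>(x, y, \<theta>)\<close>, or \<open>(x, yh, \<theta>)\<close> for the regularized system. The tangent bundle of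
  the circle is trivialized by \<open>\<partial>/\<partial>\<theta>\<close>, so a velocity is a triple of reals.\<close>

type_synonym state = "real \<times> real \<times> angle"
type_synonym velocity = "real \<times> real \<times> real"

definition xtheta :: "'a \<times> 'b \<times> 'c \<Rightarrow> 'a \<times> 'c" where
  "xtheta = (\<lambda>(x, y, \<theta>). (x, \<theta>))"

definition xi :: "real \<Rightarrow> real \<Rightarrow> angle \<Rightarrow> real" where
  "xi \<gamma> x \<theta> = \<gamma>\<^sup>2 * x + sin_angle \<theta>"

text \<open>The friction law assigns no value at \<open>y = 0\<close>, \<open>\<bar>\<xi>\<bar> = \<mu>\<^sub>s\<close>; there it is left unspecified.\<close>

definition friction :: "real \<Rightarrow> real \<Rightarrow> real \<Rightarrow> real \<Rightarrow> real" where
  "friction \<mu>\<^sub>s \<mu>\<^sub>d y \<xi> =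
    (if y \<noteq> 0 then - \<mu>\<^sub>d * sgn y
     else if \<bar>\<xi>\<bar> < \<mu>\<^sub>s then \<xi>
     else if \<bar>\<xi>\<bar> > \<mu>\<^sub>s then \<mu>\<^sub>s * sgn \<xi>
     else undefined)"

definition Z :: "real \<Rightarrow> real \<Rightarrow> real \<Rightarrow> state \<Rightarrow> velocity" where
  "Z \<gamma> \<mu>\<^sub>s \<mu>\<^sub>d = (\<lambda>(x, y, \<theta>). (y, - xi \<gamma> x \<theta> + friction \<mu>\<^sub>s \<mu>\<^sub>d y (xi \<gamma> x \<theta>), 1))"

definition Sigma_s :: "real \<Rightarrow> real \<Rightarrow> state set" where
  "Sigma_s \<gamma> \<mu>\<^sub>s = {(x, y, \<theta>). y = 0 \<and> - \<mu>\<^sub>s < xi \<gamma> x \<theta> \<and> xi \<gamma> x \<theta> < \<mu>\<^sub>s}"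

definition Z_s_sticking :: "real \<Rightarrow> real \<Rightarrow> real \<Rightarrow> real \<times> angle \<Rightarrow> real \<times> real" where
  "Z_s_sticking \<gamma> \<mu>\<^sub>s \<mu>\<^sub>d = (\<lambda>(x, \<theta>). xtheta (Z \<gamma> \<mu>\<^sub>s \<mu>\<^sub>d (x, 0, \<theta>)))"

text \<open>\<open>Z_s\<close> is the restriction of \<open>Z\<close> to \<open>\<Sigma>\<^sub>s\<close> in the coordinates \<open>(x, \<theta>)\<close>, extended by continuity
  to the closure; it is meaningful only on \<open>xtheta ` closure \<Sigma>\<^sub>s\<close>.\<close>

definition Z_s :: "real \<Rightarrow> real \<Rightarrow> real \<Rightarrow> real \<times> angle \<Rightarrow> real \<times> real" where
  "Z_s \<gamma> \<mu>\<^sub>s \<mu>\<^sub>d p =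
    (if p \<in> xtheta ` Sigma_s \<gamma> \<mu>\<^sub>s then Z_s_sticking \<gamma> \<mu>\<^sub>s \<mu>\<^sub>d p
     else Lim (at p within xtheta ` Sigma_s \<gamma> \<mu>\<^sub>s) (Z_s_sticking \<gamma> \<mu>\<^sub>s \<mu>\<^sub>d))"

definition C_k_real :: "enat \<Rightarrow> (real \<Rightarrow> real) \<Rightarrow> bool" where
  "C_k_real k f \<longleftrightarrow>
    (\<forall>n. enat n < k \<longrightarrow> (\<forall>y. (deriv ^^ n) f differentiable (at y))) \<and>
    (\<forall>n. enat n \<le> k \<longrightarrow> continuous_on UNIV ((deriv ^^ n) f))"

text \<open>For \<open>k = 1\<close> the existence of the second derivative at \<open>\<delta>\<close> is not implied by smoothness, so it is
  part of the condition \<open>\<phi>''(\<delta>) < 0\<close>.\<close>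

definition stiction_regularization ::
  "enat \<Rightarrow> real \<Rightarrow> real \<Rightarrow> real \<Rightarrow> (real \<Rightarrow> real) \<Rightarrow> bool" where
  "stiction_regularization k \<mu>\<^sub>s \<mu>\<^sub>d \<delta> \<phi> \<longleftrightarrow>
    C_k_real k \<phi> \<and>
    (\<forall>y. \<phi> (- y) = - \<phi> y) \<and>
    (\<forall>y\<ge>1. \<phi> y = 1) \<and>
    \<phi> \<delta> = \<mu>\<^sub>s / \<mu>\<^sub>d \<and>
    (\<forall>y. 0 < y \<and> y < \<delta> \<longrightarrow> deriv \<phi> y > 0) \<and>
    deriv \<phi> \<delta> = 0 \<and>
    (\<forall>y. \<delta> < y \<and> y < 1 \<longrightarrow> deriv \<phi> y < 0) \<and>
    (\<exists>c<0. (deriv \<phi> has_real_derivative c) (at \<delta>))"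

text \<open>The slow problem \<open>x' = \<epsilon> yh\<close>, \<open>\<epsilon> yh' = - \<xi> - \<mu>\<^sub>d \<phi>(yh)\<close>, \<open>\<theta>' = 1\<close> is the implicit differential equation
  \<open>slow_lhs \<epsilon> v = slow_rhs \<epsilon> z\<close> relating a state \<open>z = (x, yh, \<theta>)\<close> and its velocity \<open>v = z'\<close>.\<close>

definition slow_lhs :: "real \<Rightarrow> velocity \<Rightarrow> real \<times> real \<times> real" where
  "slow_lhs \<epsilon> = (\<lambda>(vx, vy, v\<theta>). (vx, \<epsilon> * vy, v\<theta>))"

definition slow_rhs ::
  "real \<Rightarrow> real \<Rightarrow> (real \<Rightarrow> real) \<Rightarrow> real \<Rightarrow> state \<Rightarrow> real \<times> real \<times> real" where
  "slow_rhs \<gamma> \<mu>\<^sub>d \<phi> \<epsilon> = (\<lambda>(x, yh, \<theta>). (\<epsilon> * yh, - xi \<gamma> x \<theta> - \<mu>\<^sub>d * \<phi> yh, 1))"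

definition reduced_problem ::
  "real \<Rightarrow> real \<Rightarrow> (real \<Rightarrow> real) \<Rightarrow> state \<Rightarrow> velocity \<Rightarrow> bool" where
  "reduced_problem \<gamma> \<mu>\<^sub>d \<phi> z v \<longleftrightarrow>
    Lim (at_right 0) (\<lambda>\<epsilon>. slow_lhs \<epsilon> v) = Lim (at_right 0) (\<lambda>\<epsilon>. slow_rhs \<gamma> \<mu>\<^sub>d \<phi> \<epsilon> z)"

definition C0 :: "real \<Rightarrow> real \<Rightarrow> (real \<Rightarrow> real) \<Rightarrow> state set" where
  "C0 \<gamma> \<mu>\<^sub>d \<phi> = {(x, yh, \<theta>). xi \<gamma> x \<theta> + \<mu>\<^sub>d * \<phi> yh = 0}"

end

theory Submission
  imports Defs
begin

text \<open>Both vector fields are computed outright. On \<open>\<Sigma>\<^sub>s\<close> friction cancels \<open>\<xi>\<close>, so \<open>Z\<close> is the constant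
  \<open>(0, 0, 1)\<close>, and the constant extends to the closure. The limit of the slow problem is
  \<open>(x', 0, \<theta>') = (0, -\<xi> - \<mu>\<^sub>d \<phi>(yh), 1)\<close>, which has a solution precisely on the critical manifold. The two domains agree
  because \<open>\<phi>\<close> is odd and continuous with maximum \<open>\<phi>(\<delta>) = \<mu>\<^sub>s / \<mu>\<^sub>d\<close>: its range is
  \<open>[-\<mu>\<^sub>s / \<mu>\<^sub>d, \<mu>\<^sub>s / \<mu>\<^sub>d]\<close>, so \<open>C\<^sub>0\<close> projects onto \<open>\<bar>\<xi>\<bar> \<le> \<mu>\<^sub>s\<close>.\<close>

text \<open>Continuity descends from \<open>sin\<close> because openness on the circle is tested
  after pulling back along \<open>angle_of\<close>.\<close>

lemma continuous_on_sin_angle: "continuous_on UNIV sin_angle"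
proof -
  have "angle_of -` (sin_angle -` B) = sin -` B" for B :: "real set"
    by (auto simp: sin_angle.abs_eq)
  moreover have "open (sin -` B)" if "open B" for B :: "real set"
    using that by (intro open_vimage continuous_intros)
  ultimately show ?thesis
    by (simp add: continuous_on_open_vimage open_angle_def)
qed

lemma continuous_on_xi: "continuous_on UNIV (\<lambda>z::state. xi \<gamma> (fst z) (snd (snd z)))"
  unfolding xi_def
  by (intro continuous_intros continuous_on_compose2[OF continuous_on_sin_angle]) auto

lemma continuous_on_xtheta:
  "continuous_on A (xtheta :: 'a::topological_space \<times> 'b::topological_space \<times> 'c::topological_space \<Rightarrow> _)"
  unfolding xtheta_def case_prod_beta by (intro continuous_intros)

text \<open>Boundary points are reached from inside the strip: \<open>xi\<close> is affine in
  \<open>x\<close> with nonzero slope \<open>\<gamma>\<^sup>2\<close>, so shifting \<open>x\<close>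
  alone can shrink its modulus.\<close>

lemma closure_Sigma_s:
  assumes "\<gamma> > 0" and "\<mu>\<^sub>s > 0"
  shows "closure (Sigma_s \<gamma> \<mu>\<^sub>s) = {(x, y, \<theta>). y = 0 \<and> \<bar>xi \<gamma> x \<theta>\<bar> \<le> \<mu>\<^sub>s}" (is "_ = ?K")
proof
  have "closed {z::state. fst (snd z) = 0 \<and> \<bar>xi \<gamma> (fst z) (snd (snd z))\<bar> \<le> \<mu>\<^sub>s}"
    by (intro closed_Collect_conj closed_Collect_eq closed_Collect_le continuous_intros
        continuous_on_xi)
  moreover have "{z::state. fst (snd z) = 0 \<and> \<bar>xi \<gamma> (fst z) (snd (snd z))\<bar> \<le> \<mu>\<^sub>s} = ?K"
    by auto
  ultimately have "closed ?K" by simp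
  moreover have "Sigma_s \<gamma> \<mu>\<^sub>s \<subseteq> ?K" by (auto simp: Sigma_s_def)
  ultimately show "closure (Sigma_s \<gamma> \<mu>\<^sub>s) \<subseteq> ?K" by (rule closure_minimal[rotated])
next
  show "?K \<subseteq> closure (Sigma_s \<gamma> \<mu>\<^sub>s)"
  proof clarify
    fix x \<theta> assume le: "\<bar>xi \<gamma> x \<theta>\<bar> \<le> \<mu>\<^sub>s"
    \<comment> \<open>Moving \<open>x\<close> alone along this segment scales \<open>\<xi>\<close> by \<open>1 - t\<close>.\<close>
    define q :: "real \<Rightarrow> state" where "q t = (x - t * xi \<gamma> x \<theta> / \<gamma>\<^sup>2, 0, \<theta>)" for t
    have "q t \<in> Sigma_s \<gamma> \<mu>\<^sub>s" if t: "0 < t" "t < 1" for t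
    proof -
      have "xi \<gamma> (x - t * xi \<gamma> x \<theta> / \<gamma>\<^sup>2) \<theta> = (1 - t) * xi \<gamma> x \<theta>"
        using \<open>\<gamma> > 0\<close> by (simp add: xi_def right_diff_distrib left_diff_distrib)
      moreover have "\<bar>(1 - t) * xi \<gamma> x \<theta>\<bar> < \<mu>\<^sub>s"
      proof -
        have "\<bar>(1 - t) * xi \<gamma> x \<theta>\<bar> \<le> (1 - t) * \<mu>\<^sub>s"
          using le t by (simp add: abs_mult mult_left_mono)
        also have "\<dots> < \<mu>\<^sub>s" using t assms by (simp add: algebra_simps)
        finally show ?thesis .
      qed
      ultimately show ?thesis by (simp add: q_def Sigma_s_def abs_less_iff)
    qed
    then have "\<forall>\<^sub>F t in at_right 0. q t \<in> closure (Sigma_s \<gamma> \<mu>\<^sub>s)"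
      by (auto simp: eventually_at_right[of 0 1] intro!: exI[of _ 1] subsetD[OF closure_subset])
    moreover have "(q \<longlongrightarrow> q 0) (at_right 0)"
      unfolding q_def using assms by (auto intro!: tendsto_eq_intros)
    ultimately have "q 0 \<in> closure (Sigma_s \<gamma> \<mu>\<^sub>s)"
      by (intro Lim_in_closed_set[of "closure (Sigma_s \<gamma> \<mu>\<^sub>s)" q "at_right 0"]) auto
    then show "(x, 0, \<theta>) \<in> closure (Sigma_s \<gamma> \<mu>\<^sub>s)" by (simp add: q_def)
  qed
qed

text \<open>The vanishing middle component is tangency to the plane y = 0, which makes the
  restriction a planar field in x and \<theta>.\<close>

lemma Z_on_Sigma_s:
  assumes "z \<in> Sigma_s \<gamma> \<mu>\<^sub>s"
  shows "Z \<gamma> \<mu>\<^sub>s \<mu>\<^sub>d z = (0, 0, 1)"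
  using assms by (auto simp: Sigma_s_def Z_def friction_def abs_less_iff)

lemma Z_s_sticking_on_Sigma_s:
  assumes "p \<in> xtheta ` Sigma_s \<gamma> \<mu>\<^sub>s"
  shows "Z_s_sticking \<gamma> \<mu>\<^sub>s \<mu>\<^sub>d p = (0, 1)"
proof -
  obtain x \<theta> where p: "p = (x, \<theta>)" and mem: "(x, 0, \<theta>) \<in> Sigma_s \<gamma> \<mu>\<^sub>s"
    using assms by (auto simp: xtheta_def Sigma_s_def)
  show ?thesis using Z_on_Sigma_s[OF mem] by (simp add: p Z_s_sticking_def xtheta_def)
qed

lemma Z_s_eq:
  assumes "p \<in> xtheta ` closure (Sigma_s \<gamma> \<mu>\<^sub>s)"
  shows "Z_s \<gamma> \<mu>\<^sub>s \<mu>\<^sub>d p = (0, 1)"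
proof (cases "p \<in> xtheta ` Sigma_s \<gamma> \<mu>\<^sub>s")
  case True
  then show ?thesis by (simp add: Z_s_def Z_s_sticking_on_Sigma_s)
next
  case False
  let ?S = "xtheta ` Sigma_s \<gamma> \<mu>\<^sub>s"
  have "p \<in> closure ?S"
    using assms image_closure_subset[OF continuous_on_xtheta closed_closure closure_subset]
    by blast
  \<comment> \<open>A point of the closure outside the set is a limit point, so \<open>Lim\<close>
    here is determined uniquely.\<close>
  with False have "at p within ?S \<noteq> bot"
    by (simp add: closure_def trivial_limit_within)
  moreover have "(Z_s_sticking \<gamma> \<mu>\<^sub>s \<mu>\<^sub>d \<longlongrightarrow> (0, 1)) (at p within ?S)"
    by (rule tendsto_eventually)
      (auto simp: eventually_at_topological Z_s_sticking_on_Sigma_s intro!: exI[of _ UNIV])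
  ultimately have "Lim (at p within ?S) (Z_s_sticking \<gamma> \<mu>\<^sub>s \<mu>\<^sub>d) = (0, 1)"
    by (rule tendsto_Lim)
  with False show ?thesis by (simp add: Z_s_def)
qed

text \<open>The factor \<open>\<epsilon>\<close> removes \<open>vy\<close> in the limit: the middle
  equation degenerates into the constraint defining \<open>C0\<close>, the middle velocity stays
  free, and the outer two components are fixed.\<close>

lemma reduced_problem_iff:
  "reduced_problem \<gamma> \<mu>\<^sub>d \<phi> z v \<longleftrightarrow> z \<in> C0 \<gamma> \<mu>\<^sub>d \<phi> \<and> xtheta v = (0, 1)"
proof -
  obtain x yh \<theta> where z: "z = (x, yh, \<theta>)" by (cases z)
  obtain vx vy v\<theta> where v: "v = (vx, vy, v\<theta>)" by (cases v)
  have "((\<lambda>\<epsilon>. slow_lhs \<epsilon> v) \<longlongrightarrow> (vx, 0, v\<theta>)) (at_right 0)"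
    unfolding slow_lhs_def v by (auto intro!: tendsto_eq_intros)
  then have lhs: "Lim (at_right 0) (\<lambda>\<epsilon>. slow_lhs \<epsilon> v) = (vx, 0, v\<theta>)"
    by (intro tendsto_Lim) auto
  have "((\<lambda>\<epsilon>. slow_rhs \<gamma> \<mu>\<^sub>d \<phi> \<epsilon> z) \<longlongrightarrow> (0, - xi \<gamma> x \<theta> - \<mu>\<^sub>d * \<phi> yh, 1)) (at_right 0)"
    unfolding slow_rhs_def z by (auto intro!: tendsto_eq_intros)
  then have rhs: "Lim (at_right 0) (\<lambda>\<epsilon>. slow_rhs \<gamma> \<mu>\<^sub>d \<phi> \<epsilon> z) = (0, - xi \<gamma> x \<theta> - \<mu>\<^sub>d * \<phi> yh, 1)"
    by (intro tendsto_Lim) auto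
  show ?thesis
    unfolding reduced_problem_def lhs rhs by (auto simp: z v C0_def xtheta_def)
qed

lemma range_stiction_regularization:
  assumes reg: "stiction_regularization k \<mu>\<^sub>s \<mu>\<^sub>d \<delta> \<phi>"
    and "1 \<le> k" and "0 < \<delta>" and "\<delta> < 1"
  shows "range \<phi> = {- (\<mu>\<^sub>s / \<mu>\<^sub>d)..\<mu>\<^sub>s / \<mu>\<^sub>d}"
proof
  let ?M = "\<mu>\<^sub>s / \<mu>\<^sub>d"
  have odd: "\<phi> (- y) = - \<phi> y" for y
    using reg by (simp add: stiction_regularization_def)
  have one: "\<phi> y = 1" if "y \<ge> 1" for y
    using reg that by (simp add: stiction_regularization_def)
  have at_delta: "\<phi> \<delta> = ?M"
    using reg by (simp add: stiction_regularization_def)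
  have inc: "deriv \<phi> y > 0" if "0 < y" "y < \<delta>" for y
    using reg that by (simp add: stiction_regularization_def)
  have dec: "deriv \<phi> y < 0" if "\<delta> < y" "y < 1" for y
    using reg that by (simp add: stiction_regularization_def)
  \<comment> \<open>This activates the clause n = 0 of \<open>C_k_real\<close>, differentiability of
    \<open>\<phi>\<close> itself.\<close>
  have "enat 0 < k"
    using \<open>1 \<le> k\<close> by (auto simp: zero_enat_def[symmetric])
  then have "(deriv ^^ 0) \<phi> differentiable (at y)" for y
    using reg unfolding stiction_regularization_def C_k_real_def by blast
  then have diff: "(\<phi> has_real_derivative deriv \<phi> y) (at y)" for y
    by (simp add: DERIV_deriv_iff_real_differentiable)
  then have cont: "continuous_on A \<phi>" for A
    by (meson DERIV_isCont continuous_at_imp_continuous_on)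
  \<comment> \<open>The lower bound 0 forces \<open>?M\<close> to be nonnegative, hence
    \<open>- ?M \<le> \<phi> y\<close> for such y; oddness then handles negative y.\<close>
  have bounds: "0 \<le> \<phi> y \<and> \<phi> y \<le> ?M" if "0 \<le> y" for y
  proof -
    have "\<phi> 0 = 0" using odd[of 0] by simp
    \<comment> \<open>The sign of the derivative is used only in the open interval; continuity
      carries monotonicity to the endpoints.\<close>
    have up: "\<phi> a \<le> \<phi> b" if "0 \<le> a" "a \<le> b" "b \<le> \<delta>" for a b
      using that cont diff inc
      by (intro DERIV_nonneg_imp_increasing_open[of a b \<phi>]) (auto intro!: exI less_imp_le)
    have down: "\<phi> b \<le> \<phi> a" if "\<delta> \<le> a" "a \<le> b" "b \<le> 1" for a b
      using that cont diff dec
      by (intro DERIV_nonpos_imp_decreasing_open[of a b \<phi>]) (auto intro!: exI less_imp_le)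
    consider "y \<le> \<delta>" | "\<delta> \<le> y" "y \<le> 1" | "1 \<le> y" by linarith
    then show ?thesis
    proof cases
      case 1
      then show ?thesis using up[of 0 y] up[of y \<delta>] \<open>\<phi> 0 = 0\<close> at_delta that by simp
    next
      case 2
      then show ?thesis using down[of \<delta> y] down[of y 1] one[of 1] at_delta by simp
    next
      case 3
      then show ?thesis using down[of \<delta> 1] one at_delta \<open>\<delta> < 1\<close> by simp
    qed
  qed
  show "range \<phi> \<subseteq> {- ?M..?M}"
  proof clarify
    fix y show "\<phi> y \<in> {- ?M..?M}"
      using bounds[of y] bounds[of "- y"] odd[of y] by (cases "0 \<le> y") auto
  qed
  show "{- ?M..?M} \<subseteq> range \<phi>"
  proof
    fix w assume "w \<in> {- ?M..?M}"
    \<comment> \<open>At \<open>- \<delta>\<close> and \<open>\<delta>\<close> the values are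
      exactly the two ends of the interval.\<close>
    then obtain y where "\<phi> y = w"
      using IVT'[of \<phi> "- \<delta>" w \<delta>] cont odd[of \<delta>] at_delta \<open>0 < \<delta>\<close> by auto
    then show "w \<in> range \<phi>" by blast
  qed
qed

text \<open>Dividing the constraint by \<open>\<mu>\<^sub>d\<close> turns solvability for
  \<open>yh\<close> into membership of the range of \<open>\<phi>\<close>.\<close>

lemma xtheta_C0:
  assumes "\<mu>\<^sub>d > 0" and "range \<phi> = {- (\<mu>\<^sub>s / \<mu>\<^sub>d)..\<mu>\<^sub>s / \<mu>\<^sub>d}"
  shows "xtheta ` C0 \<gamma> \<mu>\<^sub>d \<phi> = {(x, \<theta>). \<bar>xi \<gamma> x \<theta>\<bar> \<le> \<mu>\<^sub>s}"
proof -
  have "(\<exists>yh. xi \<gamma> x \<theta> + \<mu>\<^sub>d * \<phi> yh = 0) \<longleftrightarrow> \<bar>xi \<gamma> x \<theta>\<bar> \<le> \<mu>\<^sub>s" for x \<theta>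
  proof -
    have "(\<exists>yh. xi \<gamma> x \<theta> + \<mu>\<^sub>d * \<phi> yh = 0) \<longleftrightarrow> - xi \<gamma> x \<theta> / \<mu>\<^sub>d \<in> range \<phi>"
    proof -
      have "xi \<gamma> x \<theta> + \<mu>\<^sub>d * \<phi> yh = 0 \<longleftrightarrow> - xi \<gamma> x \<theta> / \<mu>\<^sub>d = \<phi> yh" for yh
        using assms(1) by (auto simp: field_simps)
      then show ?thesis by auto
    qed
    also have "\<dots> \<longleftrightarrow> \<bar>xi \<gamma> x \<theta>\<bar> \<le> \<mu>\<^sub>s"
      unfolding assms(2) using assms(1) by (auto simp: field_simps abs_le_iff)
    finally show ?thesis .
  qed
  moreover have "(x, \<theta>) \<in> xtheta ` C0 \<gamma> \<mu>\<^sub>d \<phi> \<longleftrightarrow> (\<exists>yh. xi \<gamma> x \<theta> + \<mu>\<^sub>d * \<phi> yh = 0)" for x \<theta>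
    by (force simp: C0_def xtheta_def image_iff)
  ultimately show ?thesis by (intro set_eqI) (simp add: split_paired_all)
qed

theorem proposition5p1:
  fixes \<gamma> \<mu>\<^sub>s \<mu>\<^sub>d \<delta> :: real and k :: enat and \<phi> :: "real \<Rightarrow> real"
  assumes "\<gamma> > 0" and "\<mu>\<^sub>s > \<mu>\<^sub>d" and "\<mu>\<^sub>d > 0" and "0 < \<delta>" and "\<delta> < 1" and "1 \<le> k"
    and "stiction_regularization k \<mu>\<^sub>s \<mu>\<^sub>d \<delta> \<phi>"
  shows "(\<forall>z\<in>Sigma_s \<gamma> \<mu>\<^sub>s. fst (snd (Z \<gamma> \<mu>\<^sub>s \<mu>\<^sub>d z)) = 0) \<and>
    (\<forall>z v. reduced_problem \<gamma> \<mu>\<^sub>d \<phi> z v \<longrightarrow> z \<in> C0 \<gamma> \<mu>\<^sub>d \<phi>) \<and>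
    xtheta ` C0 \<gamma> \<mu>\<^sub>d \<phi> = xtheta ` closure (Sigma_s \<gamma> \<mu>\<^sub>s) \<and>
    (\<forall>z\<in>C0 \<gamma> \<mu>\<^sub>d \<phi>. {xtheta v |v. reduced_problem \<gamma> \<mu>\<^sub>d \<phi> z v} = {Z_s \<gamma> \<mu>\<^sub>s \<mu>\<^sub>d (xtheta z)}) \<and>
    (\<forall>p\<in>xtheta ` closure (Sigma_s \<gamma> \<mu>\<^sub>s). Z_s \<gamma> \<mu>\<^sub>s \<mu>\<^sub>d p = (0, 1))"
proof -
  \<comment> \<open>The closure is required: \<open>yh = \<delta>\<close> and
    \<open>yh = - \<delta>\<close> on \<open>C0\<close> give \<open>xi\<close> equal to
    \<open>- \<mu>\<^sub>s\<close> and \<open>\<mu>\<^sub>s\<close>.\<close>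
  have proj: "xtheta ` C0 \<gamma> \<mu>\<^sub>d \<phi> = xtheta ` closure (Sigma_s \<gamma> \<mu>\<^sub>s)"
  proof -
    have "xtheta ` C0 \<gamma> \<mu>\<^sub>d \<phi> = {(x, \<theta>). \<bar>xi \<gamma> x \<theta>\<bar> \<le> \<mu>\<^sub>s}"
      using assms by (intro xtheta_C0 range_stiction_regularization) auto
    also have "\<dots> = xtheta ` closure (Sigma_s \<gamma> \<mu>\<^sub>s)"
      using assms by (subst closure_Sigma_s) (force simp: xtheta_def image_iff)+
    finally show ?thesis .
  qed
  have "{xtheta v |v. reduced_problem \<gamma> \<mu>\<^sub>d \<phi> z v} = {Z_s \<gamma> \<mu>\<^sub>s \<mu>\<^sub>d (xtheta z)}"
    if "z \<in> C0 \<gamma> \<mu>\<^sub>d \<phi>" for z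
  proof -
    have "xtheta z \<in> xtheta ` closure (Sigma_s \<gamma> \<mu>\<^sub>s)" using that proj by blast
    \<comment> \<open>A witness velocity, so that the set of projected velocities is a singleton
      rather than empty; its middle entry is arbitrary.\<close>
    moreover have "xtheta (0, 0 :: real, 1) = (0 :: real, 1 :: real)" by (simp add: xtheta_def)
    ultimately show ?thesis
      using that by (auto simp: reduced_problem_iff Z_s_eq) metis
  qed
  with proj show ?thesis
    by (auto simp: Z_on_Sigma_s reduced_problem_iff Z_s_eq)
qed

end
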